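(* Let $\exists\alpha A$ be a formula of $\mathcal L$. Suppose $t$ is a term of $\mathsf{LC}^\star$ with $t\Vdash\exists\alpha A$, $t$ contains neither free proof variables nor any abort constant $\mathcal A$, and $t\succ^*u$ with $u$ a head normal form. Then $u$ is an Herbrand normal form $$u=(m_0,v_0)\parallel_{a_1}(m_1,v_1)\parallel_{a_2}\cdots\parallel_{a_k}(m_k,v_k)$$ and $\mathsf{LC}\vdash A[m_0/\alpha]\vee A[m_1/\alpha]\vee\cdots\vee A[m_k/\alpha]$.
   Context: Formulas. Terms of the first-order language $\mathcal{L}$ are individual variables, constants, and $f(m_1,\dots,m_n)$; atomic formulas are $P(m_1,\dots,m_n)$ including $0$-ary $\bot$; formulas are built with $\wedge,\vee,\to,\forall\alpha,\exists\alpha$. Proof terms of $\mathsf{LC}$ (Church-typed): $x^A:A$; $\langle u,t\rangle:A\wedge B$ from $u:A,t:B$; $u\pi_0:A$, $u\pi_1:B$ from $u:A\wedge B$; $tu:B$ from $t:A\to B,u:A$; $\lambda x^Au:A\to B$ from $u:B$; $\iota_0(u):A\vee B$ from $u:A$, $\iota_1(u):A\vee B$ from $u:B$; $u[x^A.w_1,y^B.w_2]:C$ from $u:A\vee B$, $w_1,w_2:C$; $um:A[m/\alpha]$ from $u:\forall\alpha A$; $\lambda\alpha u:\forall\alpha A$ from $u:A$ ($\alpha$ not free in types of free proof variables of $u$); $(m,u):\exists\alpha A$ from $u:A[m/\alpha]$; $u[(\alpha,x^A).t]:C$ from $u:\exists\alpha A$, $t:C$ (usual eigenvariable condition); $u\parallel_a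 v:C$ from $u:C$, $v:C$, where $a$ occurs in $u$ with type $A\to B$ and in $v$ with type $B\to A$, $\parallel_a$ binding $a$; $\mathsf{efq}_P(u):P$ from $u:\bot$, $P$ atomic. $\mathsf{LC}^\star$ adds constants $\mathcal A^{A\to B}:A\to B$ (abort) for all $A,B$. $\mathsf{LC}\vdash B$ means there is a proof term $s$ of $\mathsf{LC}$ with no free proof variables and $s:B$. Stacks: finite sequences $\sigma=\sigma_1\cdot\ldots\cdot\sigma_n$ with components proof terms, terms of $\mathcal L$, $\pi_0,\pi_1$, $[x.u,y.v]$, $[(\alpha,x).v]$; $\epsilon$ empty; $t\sigma=((t\sigma_1)\ldots)\sigma_n$. Parallel context: $u_1\parallel_{a_1}\cdots[\,]\cdots\parallel_{a_n}u_n$. Basic reductions: $(\lambda xu)t\mapsto u[t/x]$; $(\lambda\alpha u)m\mapsto u[m/\alpha]$; $\langle u_0,u_1\rangle\pi_i\mapsto u_i$; $\iota_i(u)[x_0.t_0,x_1.t_1]\mapsto t_i[u/x_i]$; $(m,u)[(\alpha,x).v]\mapsto v[m/\alpha][u/x]$; $(u\parallel_a v)\xi\mapsto u\xi\parallel_a v\xi$ for $\xi$ a stack element that is a proof term, $\pi_i$, $[x.w_1,y.w_2]$ or $[(\alpha,x).w]$ in which $a$ is not free; $\mathcal C[a^{A\to B}u\sigma]\parallel_a v\mapsto\mathcal C[v[\lambda y^Bu/a^{B\to A}]]\parallel_a v$ and $v\parallel_a\mathcal C[a^{A\to B}u\sigma]\mapsto v\parallel_a\mathcal C[v[\lambda y^Bu/a^{B\to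 A}]]$ ($\mathcal C$ parallel context, $a$ free in $\mathcal C[au\sigma]$, $y$ dummy); $\mathcal Au\sigma\mapsto u$ when $\mathcal Au\sigma$ and $u$ have the same type. Head reduction $\succ$: writing $t=t_1\parallel_{a_1}\cdots\parallel_{a_n}t_{n+1}$, the $t_i$ are the parallel processes (elementary if not of the form $u\parallel_a v$). The head redex of $t$ is $h$ where $t=h\sigma$ and $h=r\xi$ with $\xi$ one stack element and $r$ one of $\lambda xu,\lambda\alpha u,\langle u,v\rangle,\iota_i(u),(m,u),u\parallel_a v$ (with $h$ a redex), or $h=t$ if $t=u\parallel_a v$ is a redex, or $h=t=\mathcal Au\sigma$ if $u$ and $t$ have the same type. The starting symbol of a redex $r\xi$ is its opening parenthesis; of a redex $u\parallel_a v$ it is the leftmost occurrence of $a$ heading an elementary process $a\,s\,\rho$. $t\succ t'$ iff $t'$ is obtained by contracting the head redex whose starting symbol is leftmost among the head redexes of the parallel processes of $t$; $\succ^*$ is its reflexive-transitive closure; $u$ is a head normal form if no $u'$ has $u\succ u'$. $\mathsf{HN}^\star$ is the set of terms of $\mathsf{LC}^\star$ with no infinite $\succ$-sequence. Realizability: $t\Vdash C$ iff $t:C$ and $t\sigma\in\mathsf{HN}^\star$ for all $\sigma\in\|C\|$, where: $\|P\|=\{\epsilon\}$ for $P$ atomic; $\|A\to B\|=\{u\cdot\sigma:u\Vdash A,\sigma\in\|B\|\}\cup\{\epsilon\}$; $\|A\wedge B\|=\{\pi_0\cdot\sigma:\sigma\in\|A\|\}\cup\{\pi_1\cdot\sigma:\sigma\in\|B\|\}\cup\{\epsilon\}$;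 $\|A\vee B\|=\{[x.u,y.v]\cdot\sigma:\forall t\,((t\Vdash A\Rightarrow u[t/x]\sigma\in\mathsf{HN}^\star)\wedge(t\Vdash B\Rightarrow v[t/y]\sigma\in\mathsf{HN}^\star))\}\cup\{\epsilon\}$; $\|\forall\alpha A\|=\{m\cdot\sigma:m\in\mathcal L,\sigma\in\|A[m/\alpha]\|\}\cup\{\epsilon\}$; $\|\exists\alpha A\|=\{[(\alpha,x).v]\cdot\sigma:\forall m\in\mathcal L\,\forall t\,(t\Vdash A[m/\alpha]\Rightarrow v[m/\alpha][t/x]\sigma\in\mathsf{HN}^\star)\}\cup\{\epsilon\}$. Herbrand normal forms: every proof term $(m,u)$ is one; if $u,v$ are, so is $u\parallel_a v$.
   Formalization: The permutation (u ∥_a v)ξ ↦ uξ ∥_a vξ is also allowed for ξ a first-order term m, as otherwise (u ∥_a v)m is stuck and refutes the claim; a need not actually occur in u and v, and tσ is tested only where it is well typed. *)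

theory Defs
  imports Main
begin

section \<open>First-order language\<close>

text \<open>A language is given by its function and predicate symbols together with their arities;
  constants are function symbols of arity 0. Falsity is not listed: it always belongs to the language.\<close>

record ('f, 'p) lang =
  funs :: "('f \<times> nat) set"
  preds :: "('p \<times> nat) set"

text \<open>Binding is represented locally namelessly: free individual variables and free proof variables
  have names, bound ones are de Bruijn indices, so that alpha-equivalent expressions are equal and
  the usual renaming conventions (including \<open>a\<close> not free in \<open>\<xi>\<close>) are met automatically.\<close>

datatype 'f trm = TFree nat | TBound nat | Fun 'f "'f trm list"

datatype ('f, 'p) fm =
    Falsum
  | Atom 'p "'f trm list"
  | Conj "('f, 'p) fm" "('f, 'p) fm"
  | Disj "('f, 'p) fm" "('f, 'p) fm"
  | Imp "('f, 'p) fm" "('f, 'p) fm"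
  | Forall "('f, 'p) fm"
  | Exists "('f, 'p) fm"

primrec atomic :: "('f, 'p) fm \<Rightarrow> bool" where
  "atomic Falsum = True"
| "atomic (Atom P ms) = True"
| "atomic (Conj A B) = False"
| "atomic (Disj A B) = False"
| "atomic (Imp A B) = False"
| "atomic (Forall A) = False"
| "atomic (Exists A) = False"

text \<open>\<open>wf_trm L n\<close> and \<open>wf_fm L n\<close>: expressions of the language \<open>L\<close> that may occur under \<open>n\<close>
  binders of individual variables. The terms and formulas of \<open>L\<close> are those with \<open>n = 0\<close>.\<close>

primrec wf_trm :: "('f, 'p) lang \<Rightarrow> nat \<Rightarrow> 'f trm \<Rightarrow> bool" where
  "wf_trm L n (TFree x) = True"
| "wf_trm L n (TBound i) = (i < n)"
| "wf_trm L n (Fun f ms) = ((f, length ms) \<in> funs L \<and> list_all (wf_trm L n) ms)"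

primrec wf_fm :: "('f, 'p) lang \<Rightarrow> nat \<Rightarrow> ('f, 'p) fm \<Rightarrow> bool" where
  "wf_fm L n Falsum = True"
| "wf_fm L n (Atom P ms) = ((P, length ms) \<in> preds L \<and> list_all (wf_trm L n) ms)"
| "wf_fm L n (Conj A B) = (wf_fm L n A \<and> wf_fm L n B)"
| "wf_fm L n (Disj A B) = (wf_fm L n A \<and> wf_fm L n B)"
| "wf_fm L n (Imp A B) = (wf_fm L n A \<and> wf_fm L n B)"
| "wf_fm L n (Forall A) = wf_fm L (Suc n) A"
| "wf_fm L n (Exists A) = wf_fm L (Suc n) A"

primrec lift_trm :: "nat \<Rightarrow> 'f trm \<Rightarrow> 'f trm" where
  "lift_trm k (TFree x) = TFree x"
| "lift_trm k (TBound i) = TBound (if i < k then i else Suc i)"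
| "lift_trm k (Fun f ms) = Fun f (map (lift_trm k) ms)"

primrec lift_fm :: "nat \<Rightarrow> ('f, 'p) fm \<Rightarrow> ('f, 'p) fm" where
  "lift_fm k Falsum = Falsum"
| "lift_fm k (Atom P ms) = Atom P (map (lift_trm k) ms)"
| "lift_fm k (Conj A B) = Conj (lift_fm k A) (lift_fm k B)"
| "lift_fm k (Disj A B) = Disj (lift_fm k A) (lift_fm k B)"
| "lift_fm k (Imp A B) = Imp (lift_fm k A) (lift_fm k B)"
| "lift_fm k (Forall A) = Forall (lift_fm (Suc k) A)"
| "lift_fm k (Exists A) = Exists (lift_fm (Suc k) A)"

text \<open>Substitution for the index \<open>k\<close>, whose binder disappears. In particular
  \<open>subst_fm 0 m A\<close> is \<open>A[m/\<alpha>]\<close> when \<open>A\<close> is the body of \<open>\<forall>\<alpha> A\<close> or \<open>\<exists>\<alpha> A\<close>.\<close>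

primrec subst_trm :: "nat \<Rightarrow> 'f trm \<Rightarrow> 'f trm \<Rightarrow> 'f trm" where
  "subst_trm k m (TFree x) = TFree x"
| "subst_trm k m (TBound i) = (if i < k then TBound i else if i = k then m else TBound (i - 1))"
| "subst_trm k m (Fun f ms) = Fun f (map (subst_trm k m) ms)"

primrec subst_fm :: "nat \<Rightarrow> 'f trm \<Rightarrow> ('f, 'p) fm \<Rightarrow> ('f, 'p) fm" where
  "subst_fm k m Falsum = Falsum"
| "subst_fm k m (Atom P ms) = Atom P (map (subst_trm k m) ms)"
| "subst_fm k m (Conj A B) = Conj (subst_fm k m A) (subst_fm k m B)"
| "subst_fm k m (Disj A B) = Disj (subst_fm k m A) (subst_fm k m B)"
| "subst_fm k m (Imp A B) = Imp (subst_fm k m A) (subst_fm k m B)"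
| "subst_fm k m (Forall A) = Forall (subst_fm (Suc k) (lift_trm 0 m) A)"
| "subst_fm k m (Exists A) = Exists (subst_fm (Suc k) (lift_trm 0 m) A)"


section \<open>Proof terms\<close>

text \<open>Raw proof terms of \<open>LC\<^sup>\<star>\<close>, mutually with stack elements; every elimination is \<open>Elim t \<xi>\<close> for
  a stack element \<open>\<xi>\<close>. As the calculus is Church-typed, enough annotations are kept for types to be
  unique:
    \<open>Free x A\<close> is the free variable \<open>x\<^sup>A\<close>;
    \<open>Inj0 B u\<close> is \<open>\<iota>\<^sub>0(u) : A \<or> B\<close> and \<open>Inj1 A u\<close> is \<open>\<iota>\<^sub>1(u) : A \<or> B\<close>;
    \<open>Wit A m u\<close> is \<open>(m, u) : \<exists>\<alpha> A\<close>;
    \<open>Par A B u v\<close> is \<open>u \<parallel>\<^sub>a v\<close>, where \<open>a\<close> (index 0 in both \<open>u\<close> and \<open>v\<close>) has type \<open>A \<rightarrow> B\<close>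
      in \<open>u\<close> and \<open>B \<rightarrow> A\<close> in \<open>v\<close>;
    \<open>Case A u B v\<close> is \<open>[x\<^sup>A.u, y\<^sup>B.v]\<close>;
    \<open>Unpack A v\<close> is \<open>[(\<alpha>, x\<^sup>A).v]\<close>, which binds an individual and a proof variable in \<open>v\<close>.\<close>

datatype ('f, 'p) pterm =
    Free nat "('f, 'p) fm"
  | Bound nat
  | Abort "('f, 'p) fm" "('f, 'p) fm"
  | Tuple "('f, 'p) pterm" "('f, 'p) pterm"
  | Lam "('f, 'p) fm" "('f, 'p) pterm"
  | TLam "('f, 'p) pterm"
  | Inj0 "('f, 'p) fm" "('f, 'p) pterm"
  | Inj1 "('f, 'p) fm" "('f, 'p) pterm"
  | Wit "('f, 'p) fm" "'f trm" "('f, 'p) pterm"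
  | Par "('f, 'p) fm" "('f, 'p) fm" "('f, 'p) pterm" "('f, 'p) pterm"
  | Efq "('f, 'p) fm" "('f, 'p) pterm"
  | Elim "('f, 'p) pterm" "('f, 'p) elem"
and ('f, 'p) elem =
    Arg "('f, 'p) pterm"
  | TArg "'f trm"
  | Proj0
  | Proj1
  | Case "('f, 'p) fm" "('f, 'p) pterm" "('f, 'p) fm" "('f, 'p) pterm"
  | Unpack "('f, 'p) fm" "('f, 'p) pterm"

type_synonym ('f, 'p) stack = "('f, 'p) elem list"

definition app_stack :: "('f, 'p) pterm \<Rightarrow> ('f, 'p) stack \<Rightarrow> ('f, 'p) pterm" (infixl "\<bullet>" 65) where
  "t \<bullet> \<sigma> = foldl Elim t \<sigma>"

text \<open>Lifting of individual indices (\<open>ilift\<close>) and of proof indices (\<open>plift\<close>). The type of a free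
  proof variable contains no indices (see the typing rules), hence is left alone.\<close>

primrec ilift :: "nat \<Rightarrow> ('f, 'p) pterm \<Rightarrow> ('f, 'p) pterm"
  and ilift_elem :: "nat \<Rightarrow> ('f, 'p) elem \<Rightarrow> ('f, 'p) elem" where
  "ilift k (Free x A) = Free x A"
| "ilift k (Bound i) = Bound i"
| "ilift k (Abort A B) = Abort (lift_fm k A) (lift_fm k B)"
| "ilift k (Tuple u v) = Tuple (ilift k u) (ilift k v)"
| "ilift k (Lam A u) = Lam (lift_fm k A) (ilift k u)"
| "ilift k (TLam u) = TLam (ilift (Suc k) u)"
| "ilift k (Inj0 B u) = Inj0 (lift_fm k B) (ilift k u)"
| "ilift k (Inj1 A u) = Inj1 (lift_fm k A) (ilift k u)"
| "ilift k (Wit A m u) = Wit (lift_fm (Suc k) A) (lift_trm k m) (ilift k u)"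
| "ilift k (Par A B u v) = Par (lift_fm k A) (lift_fm k B) (ilift k u) (ilift k v)"
| "ilift k (Efq P u) = Efq (lift_fm k P) (ilift k u)"
| "ilift k (Elim u \<xi>) = Elim (ilift k u) (ilift_elem k \<xi>)"
| "ilift_elem k (Arg u) = Arg (ilift k u)"
| "ilift_elem k (TArg m) = TArg (lift_trm k m)"
| "ilift_elem k Proj0 = Proj0"
| "ilift_elem k Proj1 = Proj1"
| "ilift_elem k (Case A u B v) = Case (lift_fm k A) (ilift k u) (lift_fm k B) (ilift k v)"
| "ilift_elem k (Unpack A v) = Unpack (lift_fm (Suc k) A) (ilift (Suc k) v)"

primrec plift :: "nat \<Rightarrow> ('f, 'p) pterm \<Rightarrow> ('f, 'p) pterm"
  and plift_elem :: "nat \<Rightarrow> ('f, 'p) elem \<Rightarrow> ('f, 'p) elem" where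
  "plift k (Free x A) = Free x A"
| "plift k (Bound i) = Bound (if i < k then i else Suc i)"
| "plift k (Abort A B) = Abort A B"
| "plift k (Tuple u v) = Tuple (plift k u) (plift k v)"
| "plift k (Lam A u) = Lam A (plift (Suc k) u)"
| "plift k (TLam u) = TLam (plift k u)"
| "plift k (Inj0 B u) = Inj0 B (plift k u)"
| "plift k (Inj1 A u) = Inj1 A (plift k u)"
| "plift k (Wit A m u) = Wit A m (plift k u)"
| "plift k (Par A B u v) = Par A B (plift (Suc k) u) (plift (Suc k) v)"
| "plift k (Efq P u) = Efq P (plift k u)"
| "plift k (Elim u \<xi>) = Elim (plift k u) (plift_elem k \<xi>)"
| "plift_elem k (Arg u) = Arg (plift k u)"
| "plift_elem k (TArg m) = TArg m"
| "plift_elem k Proj0 = Proj0"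
| "plift_elem k Proj1 = Proj1"
| "plift_elem k (Case A u B v) = Case A (plift (Suc k) u) B (plift (Suc k) v)"
| "plift_elem k (Unpack A v) = Unpack A (plift (Suc k) v)"

text \<open>\<open>isubst k m u\<close> substitutes the first-order term \<open>m\<close> for the individual index \<open>k\<close>,
  \<open>psubst k t u\<close> the proof term \<open>t\<close> for the proof index \<open>k\<close>; both remove the binder.\<close>

primrec isubst :: "nat \<Rightarrow> 'f trm \<Rightarrow> ('f, 'p) pterm \<Rightarrow> ('f, 'p) pterm"
  and isubst_elem :: "nat \<Rightarrow> 'f trm \<Rightarrow> ('f, 'p) elem \<Rightarrow> ('f, 'p) elem" where
  "isubst k m (Free x A) = Free x A"
| "isubst k m (Bound i) = Bound i"
| "isubst k m (Abort A B) = Abort (subst_fm k m A) (subst_fm k m B)"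
| "isubst k m (Tuple u v) = Tuple (isubst k m u) (isubst k m v)"
| "isubst k m (Lam A u) = Lam (subst_fm k m A) (isubst k m u)"
| "isubst k m (TLam u) = TLam (isubst (Suc k) (lift_trm 0 m) u)"
| "isubst k m (Inj0 B u) = Inj0 (subst_fm k m B) (isubst k m u)"
| "isubst k m (Inj1 A u) = Inj1 (subst_fm k m A) (isubst k m u)"
| "isubst k m (Wit A m' u) =
     Wit (subst_fm (Suc k) (lift_trm 0 m) A) (subst_trm k m m') (isubst k m u)"
| "isubst k m (Par A B u v) = Par (subst_fm k m A) (subst_fm k m B) (isubst k m u) (isubst k m v)"
| "isubst k m (Efq P u) = Efq (subst_fm k m P) (isubst k m u)"
| "isubst k m (Elim u \<xi>) = Elim (isubst k m u) (isubst_elem k m \<xi>)"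
| "isubst_elem k m (Arg u) = Arg (isubst k m u)"
| "isubst_elem k m (TArg m') = TArg (subst_trm k m m')"
| "isubst_elem k m Proj0 = Proj0"
| "isubst_elem k m Proj1 = Proj1"
| "isubst_elem k m (Case A u B v) =
     Case (subst_fm k m A) (isubst k m u) (subst_fm k m B) (isubst k m v)"
| "isubst_elem k m (Unpack A v) =
     Unpack (subst_fm (Suc k) (lift_trm 0 m) A) (isubst (Suc k) (lift_trm 0 m) v)"

primrec psubst :: "nat \<Rightarrow> ('f, 'p) pterm \<Rightarrow> ('f, 'p) pterm \<Rightarrow> ('f, 'p) pterm"
  and psubst_elem :: "nat \<Rightarrow> ('f, 'p) pterm \<Rightarrow> ('f, 'p) elem \<Rightarrow> ('f, 'p) elem" where
  "psubst k t (Free x A) = Free x A"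
| "psubst k t (Bound i) = (if i < k then Bound i else if i = k then t else Bound (i - 1))"
| "psubst k t (Abort A B) = Abort A B"
| "psubst k t (Tuple u v) = Tuple (psubst k t u) (psubst k t v)"
| "psubst k t (Lam A u) = Lam A (psubst (Suc k) (plift 0 t) u)"
| "psubst k t (TLam u) = TLam (psubst k (ilift 0 t) u)"
| "psubst k t (Inj0 B u) = Inj0 B (psubst k t u)"
| "psubst k t (Inj1 A u) = Inj1 A (psubst k t u)"
| "psubst k t (Wit A m u) = Wit A m (psubst k t u)"
| "psubst k t (Par A B u v) =
     Par A B (psubst (Suc k) (plift 0 t) u) (psubst (Suc k) (plift 0 t) v)"
| "psubst k t (Efq P u) = Efq P (psubst k t u)"
| "psubst k t (Elim u \<xi>) = Elim (psubst k t u) (psubst_elem k t \<xi>)"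
| "psubst_elem k t (Arg u) = Arg (psubst k t u)"
| "psubst_elem k t (TArg m) = TArg m"
| "psubst_elem k t Proj0 = Proj0"
| "psubst_elem k t Proj1 = Proj1"
| "psubst_elem k t (Case A u B v) =
     Case A (psubst (Suc k) (plift 0 t) u) B (psubst (Suc k) (plift 0 t) v)"
| "psubst_elem k t (Unpack A v) = Unpack A (psubst (Suc k) (plift 0 (ilift 0 t)) v)"

primrec free_pvars :: "('f, 'p) pterm \<Rightarrow> (nat \<times> ('f, 'p) fm) set"
  and free_pvars_elem :: "('f, 'p) elem \<Rightarrow> (nat \<times> ('f, 'p) fm) set" where
  "free_pvars (Free x A) = {(x, A)}"
| "free_pvars (Bound i) = {}"
| "free_pvars (Abort A B) = {}"
| "free_pvars (Tuple u v) = free_pvars u \<union> free_pvars v"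
| "free_pvars (Lam A u) = free_pvars u"
| "free_pvars (TLam u) = free_pvars u"
| "free_pvars (Inj0 B u) = free_pvars u"
| "free_pvars (Inj1 A u) = free_pvars u"
| "free_pvars (Wit A m u) = free_pvars u"
| "free_pvars (Par A B u v) = free_pvars u \<union> free_pvars v"
| "free_pvars (Efq P u) = free_pvars u"
| "free_pvars (Elim u \<xi>) = free_pvars u \<union> free_pvars_elem \<xi>"
| "free_pvars_elem (Arg u) = free_pvars u"
| "free_pvars_elem (TArg m) = {}"
| "free_pvars_elem Proj0 = {}"
| "free_pvars_elem Proj1 = {}"
| "free_pvars_elem (Case A u B v) = free_pvars u \<union> free_pvars v"
| "free_pvars_elem (Unpack A v) = free_pvars v"

primrec has_abort :: "('f, 'p) pterm \<Rightarrow> bool"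
  and has_abort_elem :: "('f, 'p) elem \<Rightarrow> bool" where
  "has_abort (Free x A) = False"
| "has_abort (Bound i) = False"
| "has_abort (Abort A B) = True"
| "has_abort (Tuple u v) = (has_abort u \<or> has_abort v)"
| "has_abort (Lam A u) = has_abort u"
| "has_abort (TLam u) = has_abort u"
| "has_abort (Inj0 B u) = has_abort u"
| "has_abort (Inj1 A u) = has_abort u"
| "has_abort (Wit A m u) = has_abort u"
| "has_abort (Par A B u v) = (has_abort u \<or> has_abort v)"
| "has_abort (Efq P u) = has_abort u"
| "has_abort (Elim u \<xi>) = (has_abort u \<or> has_abort_elem \<xi>)"
| "has_abort_elem (Arg u) = has_abort u"
| "has_abort_elem (TArg m) = False"
| "has_abort_elem Proj0 = False"
| "has_abort_elem Proj1 = False"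
| "has_abort_elem (Case A u B v) = (has_abort u \<or> has_abort v)"
| "has_abort_elem (Unpack A v) = has_abort v"

text \<open>\<open>typing L n \<Gamma> t A\<close>: under \<open>n\<close> binders of individual variables and under binders of proof
  variables of types \<open>\<Gamma>\<close> (innermost first), \<open>t\<close> has type \<open>A\<close>. Free proof variables carry their types,
  so \<open>\<Gamma>\<close> concerns bound variables only. The eigenvariable conditions hold because, below a binder of
  an individual variable, \<open>\<Gamma>\<close> (and, for \<open>Unpack\<close>, the type \<open>C\<close> of the conclusion) is lifted and
  because the types of free proof variables contain no indices at all. As for any
  assumption discharged in natural deduction, the variable bound by \<open>Par\<close> need not actually occur:
  otherwise types would not be preserved by communication.\<close>

inductive typing ::
  "('f, 'p) lang \<Rightarrow> nat \<Rightarrow> ('f, 'p) fm list \<Rightarrow> ('f, 'p) pterm \<Rightarrow> ('f, 'p) fm \<Rightarrow> bool" for L where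
  Free: "wf_fm L 0 A \<Longrightarrow> typing L n \<Gamma> (Free x A) A"
| Bound: "i < length \<Gamma> \<Longrightarrow> typing L n \<Gamma> (Bound i) (\<Gamma> ! i)"
| Abort: "wf_fm L n A \<Longrightarrow> wf_fm L n B \<Longrightarrow> typing L n \<Gamma> (Abort A B) (Imp A B)"
| Tuple: "typing L n \<Gamma> u A \<Longrightarrow> typing L n \<Gamma> t B \<Longrightarrow> typing L n \<Gamma> (Tuple u t) (Conj A B)"
| Proj0: "typing L n \<Gamma> u (Conj A B) \<Longrightarrow> typing L n \<Gamma> (Elim u Proj0) A"
| Proj1: "typing L n \<Gamma> u (Conj A B) \<Longrightarrow> typing L n \<Gamma> (Elim u Proj1) B"
| Lam: "wf_fm L n A \<Longrightarrow> typing L n (A # \<Gamma>) u B \<Longrightarrow> typing L n \<Gamma> (Lam A u) (Imp A B)"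
| Arg: "typing L n \<Gamma> t (Imp A B) \<Longrightarrow> typing L n \<Gamma> u A \<Longrightarrow> typing L n \<Gamma> (Elim t (Arg u)) B"
| Inj0: "wf_fm L n B \<Longrightarrow> typing L n \<Gamma> u A \<Longrightarrow> typing L n \<Gamma> (Inj0 B u) (Disj A B)"
| Inj1: "wf_fm L n A \<Longrightarrow> typing L n \<Gamma> u B \<Longrightarrow> typing L n \<Gamma> (Inj1 A u) (Disj A B)"
| Case: "typing L n \<Gamma> u (Disj A B) \<Longrightarrow> typing L n (A # \<Gamma>) w1 C \<Longrightarrow> typing L n (B # \<Gamma>) w2 C \<Longrightarrow>
    typing L n \<Gamma> (Elim u (Case A w1 B w2)) C"
| TLam: "typing L (Suc n) (map (lift_fm 0) \<Gamma>) u A \<Longrightarrow> typing L n \<Gamma> (TLam u) (Forall A)"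
| TArg: "typing L n \<Gamma> u (Forall A) \<Longrightarrow> wf_trm L n m \<Longrightarrow>
    typing L n \<Gamma> (Elim u (TArg m)) (subst_fm 0 m A)"
| Wit: "wf_fm L n (Exists A) \<Longrightarrow> wf_trm L n m \<Longrightarrow> typing L n \<Gamma> u (subst_fm 0 m A) \<Longrightarrow>
    typing L n \<Gamma> (Wit A m u) (Exists A)"
| Unpack: "typing L n \<Gamma> u (Exists A) \<Longrightarrow>
    typing L (Suc n) (A # map (lift_fm 0) \<Gamma>) t (lift_fm 0 C) \<Longrightarrow>
    typing L n \<Gamma> (Elim u (Unpack A t)) C"
| Par: "wf_fm L n A \<Longrightarrow> wf_fm L n B \<Longrightarrow>
    typing L n (Imp A B # \<Gamma>) u C \<Longrightarrow> typing L n (Imp B A # \<Gamma>) v C \<Longrightarrow>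
    typing L n \<Gamma> (Par A B u v) C"
| Efq: "atomic P \<Longrightarrow> wf_fm L n P \<Longrightarrow> typing L n \<Gamma> u Falsum \<Longrightarrow> typing L n \<Gamma> (Efq P u) P"

abbreviation has_type :: "('f, 'p) lang \<Rightarrow> ('f, 'p) pterm \<Rightarrow> ('f, 'p) fm \<Rightarrow> bool" where
  "has_type L t A \<equiv> typing L 0 [] t A"

definition LC_star_term :: "('f, 'p) lang \<Rightarrow> ('f, 'p) pterm \<Rightarrow> bool" where
  "LC_star_term L t \<longleftrightarrow> (\<exists>A. has_type L t A)"

definition LC_provable :: "('f, 'p) lang \<Rightarrow> ('f, 'p) fm \<Rightarrow> bool" where
  "LC_provable L B \<longleftrightarrow> (\<exists>s. has_type L s B \<and> \<not> has_abort s \<and> free_pvars s = {})"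


section \<open>Basic reductions\<close>

text \<open>Parallel contexts; \<open>plug C t\<close> is \<open>C[t]\<close>, where the variables bound by \<open>C\<close> capture the
  \<open>depth C\<close> lowest proof indices of \<open>t\<close>.\<close>

datatype ('f, 'p) pctx =
    Hole
  | ParL "('f, 'p) fm" "('f, 'p) fm" "('f, 'p) pctx" "('f, 'p) pterm"
  | ParR "('f, 'p) fm" "('f, 'p) fm" "('f, 'p) pterm" "('f, 'p) pctx"

primrec plug :: "('f, 'p) pctx \<Rightarrow> ('f, 'p) pterm \<Rightarrow> ('f, 'p) pterm" where
  "plug Hole t = t"
| "plug (ParL A B C v) t = Par A B (plug C t) v"
| "plug (ParR A B u C) t = Par A B u (plug C t)"

primrec depth :: "('f, 'p) pctx \<Rightarrow> nat" where
  "depth Hole = 0"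
| "depth (ParL A B C v) = Suc (depth C)"
| "depth (ParR A B u C) = Suc (depth C)"

text \<open>Types of the proof indices at the hole of a parallel context, given the types outside.\<close>

primrec hole_types :: "('f, 'p) fm list \<Rightarrow> ('f, 'p) pctx \<Rightarrow> ('f, 'p) fm list" where
  "hole_types \<Gamma> Hole = \<Gamma>"
| "hole_types \<Gamma> (ParL A B C v) = hole_types (Imp A B # \<Gamma>) C"
| "hole_types \<Gamma> (ParR A B u C) = hole_types (Imp B A # \<Gamma>) C"

text \<open>\<open>transmit d B u v\<close> is \<open>v[\<lambda>y\<^sup>B u/a]\<close>, for \<open>v\<close> one side of \<open>\<parallel>\<^sub>a\<close>, as it is placed under \<open>d\<close> further
  parallel compositions on the other side of \<open>\<parallel>\<^sub>a\<close>, where \<open>u\<close> comes from. Hence the indices of \<open>v\<close>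
  other than \<open>a\<close> have to be raised by \<open>d + 1\<close>.\<close>

definition transmit ::
  "nat \<Rightarrow> ('f, 'p) fm \<Rightarrow> ('f, 'p) pterm \<Rightarrow> ('f, 'p) pterm \<Rightarrow> ('f, 'p) pterm" where
  "transmit d B u v = psubst 0 (Lam B (plift 0 u)) ((plift 1 ^^ Suc d) v)"

text \<open>\<open>basic L \<Gamma> t t'\<close>: the basic reduction \<open>t \<mapsto> t'\<close>; the types \<open>\<Gamma>\<close> of the bound proof variables in
  scope only matter for the reduction of \<open>Abort\<close>. In the communication rules \<open>Bound (depth C)\<close> is the
  variable \<open>a\<close> bound by the displayed parallel composition. The permutation rule covers every
  one-element stack \<open>\<xi>\<close>, including first-order terms; otherwise \<open>(u \<parallel>\<^sub>a v) m\<close> would be stuck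
  and could be a normal form of type \<open>\<exists>\<alpha> A\<close> that is not an Herbrand normal form.\<close>

inductive basic ::
  "('f, 'p) lang \<Rightarrow> ('f, 'p) fm list \<Rightarrow> ('f, 'p) pterm \<Rightarrow> ('f, 'p) pterm \<Rightarrow> bool"
  for L :: "('f, 'p) lang" and \<Gamma> :: "('f, 'p) fm list" where
  beta: "basic L \<Gamma> (Elim (Lam A u) (Arg t)) (psubst 0 t u)"
| inst: "basic L \<Gamma> (Elim (TLam u) (TArg m)) (isubst 0 m u)"
| proj0: "basic L \<Gamma> (Elim (Tuple u0 u1) Proj0) u0"
| proj1: "basic L \<Gamma> (Elim (Tuple u0 u1) Proj1) u1"
| case0: "basic L \<Gamma> (Elim (Inj0 D u) (Case A t0 B t1)) (psubst 0 u t0)"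
| case1: "basic L \<Gamma> (Elim (Inj1 D u) (Case A t0 B t1)) (psubst 0 u t1)"
| unpack: "basic L \<Gamma> (Elim (Wit A m u) (Unpack B v)) (psubst 0 u (isubst 0 m v))"
| permute: "basic L \<Gamma> (Elim (Par A B u v) \<xi>)
    (Par A B (Elim u (plift_elem 0 \<xi>)) (Elim v (plift_elem 0 \<xi>)))"
| comm_left: "basic L \<Gamma>
    (Par A B (plug C (Elim (Bound (depth C)) (Arg u) \<bullet> \<sigma>)) v)
    (Par A B (plug C (transmit (depth C) B u v)) v)"
| comm_right: "basic L \<Gamma>
    (Par A B v (plug C (Elim (Bound (depth C)) (Arg u) \<bullet> \<sigma>)))
    (Par A B v (plug C (transmit (depth C) A u v)))"
| abort: "typing L 0 \<Gamma> (Elim (Abort A B) (Arg u) \<bullet> \<sigma>) D \<Longrightarrow> typing L 0 \<Gamma> u D \<Longrightarrow>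
    basic L \<Gamma> (Elim (Abort A B) (Arg u) \<bullet> \<sigma>) u"

definition redex :: "('f, 'p) lang \<Rightarrow> ('f, 'p) fm list \<Rightarrow> ('f, 'p) pterm \<Rightarrow> bool" where
  "redex L \<Gamma> h \<longleftrightarrow> (\<exists>h'. basic L \<Gamma> h h')"


section \<open>Head reduction\<close>

text \<open>The elementary processes of a term, from left to right.\<close>

fun procs :: "('f, 'p) pterm \<Rightarrow> ('f, 'p) pterm list" where
  "procs (Par A B u v) = procs u @ procs v"
| "procs t = [t]"

primrec procs_before :: "('f, 'p) pctx \<Rightarrow> nat" where
  "procs_before Hole = 0"
| "procs_before (ParL A B C v) = procs_before C"
| "procs_before (ParR A B u C) = length (procs u) + procs_before C"

fun head_former :: "('f, 'p) pterm \<Rightarrow> bool" where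
  "head_former (Lam A u) = True"
| "head_former (TLam u) = True"
| "head_former (Tuple u v) = True"
| "head_former (Inj0 B u) = True"
| "head_former (Inj1 A u) = True"
| "head_former (Wit A m u) = True"
| "head_former (Par A B u v) = True"
| "head_former t = False"

text \<open>\<open>head_redex L \<Gamma> t h \<sigma>\<close>: \<open>t = h\<sigma>\<close> and \<open>h\<close> is the head redex of \<open>t\<close>.\<close>

inductive head_redex ::
  "('f, 'p) lang \<Rightarrow> ('f, 'p) fm list \<Rightarrow>
   ('f, 'p) pterm \<Rightarrow> ('f, 'p) pterm \<Rightarrow> ('f, 'p) stack \<Rightarrow> bool" for L \<Gamma> where
  elim: "head_former r \<Longrightarrow> redex L \<Gamma> (Elim r \<xi>) \<Longrightarrow> head_redex L \<Gamma> (Elim r \<xi> \<bullet> \<sigma>) (Elim r \<xi>) \<sigma>"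
| par: "redex L \<Gamma> (Par A B u v) \<Longrightarrow> head_redex L \<Gamma> (Par A B u v) (Par A B u v) []"
| abort: "t = Elim (Abort A B) (Arg u) \<bullet> \<sigma> \<Longrightarrow> typing L 0 \<Gamma> t D \<Longrightarrow> typing L 0 \<Gamma> u D \<Longrightarrow>
    head_redex L \<Gamma> t t []"

text \<open>The starting symbol of a head redex always lies at the head of an elementary process, and
  different head redexes of the processes of a term start in different elementary processes.
  Therefore the position of a starting symbol is given by the number of elementary
  processes to its left. \<open>start h\<close> is this position relative to the redex \<open>h\<close>; if \<open>h\<close> is
  \<open>u \<parallel>\<^sub>a v\<close>, it is that of the leftmost elementary process of the form \<open>a s \<rho>\<close>.\<close>

definition var_headed_at :: "('f, 'p) pterm \<Rightarrow> nat \<Rightarrow> bool" where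
  "var_headed_at u k \<longleftrightarrow>
     (\<exists>C s \<rho>. u = plug C (Elim (Bound (depth C)) (Arg s) \<bullet> \<rho>) \<and> k = procs_before C)"

fun start :: "('f, 'p) pterm \<Rightarrow> nat" where
  "start (Par A B u v) =
     (LEAST k. var_headed_at u k \<or> (\<exists>j. var_headed_at v j \<and> k = length (procs u) + j))"
| "start h = 0"

text \<open>The parallel processes of \<open>t\<close> are the \<open>p\<close> with \<open>t = plug C p\<close> for some \<open>C\<close>. Starting symbols only
  select the redex; a redex \<open>u \<parallel>\<^sub>a v\<close> with several processes headed by \<open>a\<close> may be contracted by any
  of the corresponding communications.\<close>

definition process_redex ::
  "('f, 'p) lang \<Rightarrow> ('f, 'p) pterm \<Rightarrow> ('f, 'p) pctx \<Rightarrow> ('f, 'p) pterm \<Rightarrow> ('f, 'p) stack \<Rightarrow> bool" where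
  "process_redex L t C h \<sigma> \<longleftrightarrow> (\<exists>p. t = plug C p \<and> head_redex L (hole_types [] C) p h \<sigma>)"

definition head_step :: "('f, 'p) lang \<Rightarrow> ('f, 'p) pterm \<Rightarrow> ('f, 'p) pterm \<Rightarrow> bool" where
  "head_step L t t' \<longleftrightarrow>
     (\<exists>C h \<sigma> h'. process_redex L t C h \<sigma> \<and>
        (\<forall>C2 h2 \<sigma>2. process_redex L t C2 h2 \<sigma>2 \<longrightarrow>
           procs_before C + start h \<le> procs_before C2 + start h2) \<and>
        basic L (hole_types [] C) h h' \<and> t' = plug C (h' \<bullet> \<sigma>))"

definition head_normal :: "('f, 'p) lang \<Rightarrow> ('f, 'p) pterm \<Rightarrow> bool" where
  "head_normal L u \<longleftrightarrow> \<not> (\<exists>u'. head_step L u u')"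

definition HN_star :: "('f, 'p) lang \<Rightarrow> ('f, 'p) pterm set" where
  "HN_star L = {t. LC_star_term L t \<and> \<not> (\<exists>s. s 0 = t \<and> (\<forall>i. head_step L (s i) (s (Suc i))))}"


section \<open>Realizability\<close>

primrec connectives :: "('f, 'p) fm \<Rightarrow> nat" where
  "connectives Falsum = 0"
| "connectives (Atom P ms) = 0"
| "connectives (Conj A B) = Suc (connectives A + connectives B)"
| "connectives (Disj A B) = Suc (connectives A + connectives B)"
| "connectives (Imp A B) = Suc (connectives A + connectives B)"
| "connectives (Forall A) = Suc (connectives A)"
| "connectives (Exists A) = Suc (connectives A)"

lemma connectives_subst [simp]: "connectives (subst_fm k m A) = connectives A"
  by (induction A arbitrary: k m) auto

text \<open>All terms being typed, \<open>t\<sigma>\<close> is only meaningful when it is a well-typed term of \<open>LC\<^sup>\<star>\<close>, so only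
  such stacks are tested in \<open>realizes\<close>. The membership conditions alone do not ensure
  this: the two branches of a \<open>Case\<close>, say, might have different types.\<close>

function realizes :: "('f, 'p) lang \<Rightarrow> ('f, 'p) pterm \<Rightarrow> ('f, 'p) fm \<Rightarrow> bool"
  and stacks :: "('f, 'p) lang \<Rightarrow> ('f, 'p) fm \<Rightarrow> ('f, 'p) stack set" where
  "realizes L t C \<longleftrightarrow>
     has_type L t C \<and> (\<forall>\<sigma> \<in> stacks L C. LC_star_term L (t \<bullet> \<sigma>) \<longrightarrow> t \<bullet> \<sigma> \<in> HN_star L)"
| "stacks L Falsum = {[]}"
| "stacks L (Atom P ms) = {[]}"
| "stacks L (Imp A B) = {Arg u # \<sigma> | u \<sigma>. realizes L u A \<and> \<sigma> \<in> stacks L B} \<union> {[]}"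
| "stacks L (Conj A B) =
     {Proj0 # \<sigma> | \<sigma>. \<sigma> \<in> stacks L A} \<union> {Proj1 # \<sigma> | \<sigma>. \<sigma> \<in> stacks L B} \<union> {[]}"
| "stacks L (Disj A B) =
     {Case A u B v # \<sigma> | u v \<sigma>.
        \<forall>t. (realizes L t A \<longrightarrow> psubst 0 t u \<bullet> \<sigma> \<in> HN_star L) \<and>
            (realizes L t B \<longrightarrow> psubst 0 t v \<bullet> \<sigma> \<in> HN_star L)} \<union> {[]}"
| "stacks L (Forall A) =
     {TArg m # \<sigma> | m \<sigma>. wf_trm L 0 m \<and> \<sigma> \<in> stacks L (subst_fm 0 m A)} \<union> {[]}"
| "stacks L (Exists A) =
     {Unpack A v # \<sigma> | v \<sigma>.
        \<forall>m t. wf_trm L 0 m \<longrightarrow> realizes L t (subst_fm 0 m A) \<longrightarrow>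
          psubst 0 t (isubst 0 m v) \<bullet> \<sigma> \<in> HN_star L} \<union> {[]}"
  by pat_completeness auto
termination
  by (relation "measure (\<lambda>x. case x of Inl (L, t, C) \<Rightarrow> 2 * connectives C + 1
                                      | Inr (L, C) \<Rightarrow> 2 * connectives C)") auto


section \<open>Herbrand normal forms\<close>

inductive herbrand_nf :: "('f, 'p) pterm \<Rightarrow> bool" where
  wit: "herbrand_nf (Wit A m u)"
| par: "herbrand_nf u \<Longrightarrow> herbrand_nf v \<Longrightarrow> herbrand_nf (Par A B u v)"

fun big_disj :: "('f, 'p) fm list \<Rightarrow> ('f, 'p) fm" where
  "big_disj [] = Falsum"
| "big_disj [A] = A"
| "big_disj (A # As) = Disj A (big_disj As)"

end

theory Submission
  imports Defs
begin

text \<open>Head reduction preserves types and creates neither free proof variables nor aborts, so a reduct of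
  \<open>t\<close> is again a closed abort-free term of type \<open>\<exists>\<alpha> A\<close>. Each of its elementary processes is
  of the form \<open>h\<sigma>\<close> with \<open>h\<close> not an elimination. If \<open>h\<close> is a variable bound by a parallel composition,
  its type is an implication and that composition can communicate; if \<open>h\<close> is introduced by a
  constructor and \<open>\<sigma>\<close> is nonempty, there is a redex at the head; an \<open>efq\<close> has an atomic type and admits no
  elimination. What is left is \<open>(m, v)\<close>. Replacing every process \<open>(m\<^sub>i, v\<^sub>i)\<close> by an injection of
  \<open>v\<^sub>i\<close> into the disjunction yields the proof term for the disjunction.\<close>


section \<open>Index calculus for terms and formulas\<close>

lemma lift_lift_trm: "i \<le> k \<Longrightarrow> lift_trm (Suc k) (lift_trm i m) = lift_trm i (lift_trm k m)"
  by (induction m) auto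

lemma lift_lift_fm: "i \<le> k \<Longrightarrow> lift_fm (Suc k) (lift_fm i A) = lift_fm i (lift_fm k A)"
  by (induction A arbitrary: i k) (auto simp: lift_lift_trm)

lemma subst_lift_trm [simp]: "subst_trm k m (lift_trm k x) = x"
  by (induction x) (auto simp: map_idI)

lemma subst_lift_fm [simp]: "subst_fm k m (lift_fm k A) = A"
  by (induction A arbitrary: k m) (auto simp: map_idI)

lemma lift_subst_trm:
  "i \<le> k \<Longrightarrow> lift_trm k (subst_trm i m x) = subst_trm i (lift_trm k m) (lift_trm (Suc k) x)"
  by (induction x) auto

lemma lift_subst_fm:
  "i \<le> k \<Longrightarrow> lift_fm k (subst_fm i m A) = subst_fm i (lift_trm k m) (lift_fm (Suc k) A)"
  by (induction A arbitrary: i k m) (auto simp: lift_subst_trm lift_lift_trm)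

lemma subst_lift_comm_trm:
  "i \<le> k \<Longrightarrow> subst_trm (Suc k) (lift_trm i m) (lift_trm i x) = lift_trm i (subst_trm k m x)"
  by (induction x) auto

lemma subst_lift_comm_fm:
  "i \<le> k \<Longrightarrow> subst_fm (Suc k) (lift_trm i m) (lift_fm i A) = lift_fm i (subst_fm k m A)"
  by (induction A arbitrary: i k m) (auto simp: subst_lift_comm_trm lift_lift_trm[symmetric])

lemma subst_subst_trm:
  "i \<le> k \<Longrightarrow> subst_trm k m (subst_trm i m' x) =
     subst_trm i (subst_trm k m m') (subst_trm (Suc k) (lift_trm i m) x)"
  by (induction x) auto

lemma subst_subst_fm:
  "i \<le> k \<Longrightarrow> subst_fm k m (subst_fm i m' A) =
     subst_fm i (subst_trm k m m') (subst_fm (Suc k) (lift_trm i m) A)"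
  by (induction A arbitrary: i k m m')
    (auto simp: subst_subst_trm subst_lift_comm_trm lift_lift_trm[symmetric])

lemma wf_lift_trm: "wf_trm L n m \<Longrightarrow> wf_trm L (Suc n) (lift_trm k m)"
  by (induction m) (auto simp: list_all_iff)

lemma wf_lift_fm: "wf_fm L n A \<Longrightarrow> wf_fm L (Suc n) (lift_fm k A)"
  by (induction A arbitrary: n k) (auto simp: list_all_iff wf_lift_trm)

lemma wf_subst_trm:
  "wf_trm L (Suc n) x \<Longrightarrow> wf_trm L n m \<Longrightarrow> k \<le> n \<Longrightarrow> wf_trm L n (subst_trm k m x)"
  by (induction x) (auto simp: list_all_iff)

lemma wf_subst_fm:
  "wf_fm L (Suc n) A \<Longrightarrow> wf_trm L n m \<Longrightarrow> k \<le> n \<Longrightarrow> wf_fm L n (subst_fm k m A)"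
  by (induction A arbitrary: n k m) (auto simp: list_all_iff wf_subst_trm wf_lift_trm)

lemma lift_wf_trm: "wf_trm L n m \<Longrightarrow> n \<le> k \<Longrightarrow> lift_trm k m = m"
  by (induction m) (auto simp: list_all_iff map_idI)

lemma lift_wf_fm: "wf_fm L n A \<Longrightarrow> n \<le> k \<Longrightarrow> lift_fm k A = A"
  by (induction A arbitrary: n k) (auto simp: list_all_iff intro!: map_idI lift_wf_trm)

lemma subst_wf_fm: "wf_fm L 0 A \<Longrightarrow> subst_fm k m A = A"
  by (metis le0 lift_wf_fm subst_lift_fm)

lemma atomic_lift [simp]: "atomic (lift_fm k A) = atomic A"
  by (cases A) auto

lemma atomic_subst [simp]: "atomic (subst_fm k m A) = atomic A"
  by (cases A) auto


section \<open>Typing of lifted and substituted terms\<close>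

inductive_cases typing_BoundE: "typing L n \<Gamma> (Bound i) C"
inductive_cases typing_TupleE: "typing L n \<Gamma> (Tuple u v) C"
inductive_cases typing_LamE: "typing L n \<Gamma> (Lam A u) C"
inductive_cases typing_TLamE: "typing L n \<Gamma> (TLam u) C"
inductive_cases typing_Inj0E: "typing L n \<Gamma> (Inj0 A u) C"
inductive_cases typing_Inj1E: "typing L n \<Gamma> (Inj1 A u) C"
inductive_cases typing_WitE: "typing L n \<Gamma> (Wit A m u) C"
inductive_cases typing_ParE: "typing L n \<Gamma> (Par A B u v) C"
inductive_cases typing_EfqE: "typing L n \<Gamma> (Efq P u) C"
inductive_cases typing_ElimE: "typing L n \<Gamma> (Elim u \<xi>) C"
inductive_cases typing_ArgE: "typing L n \<Gamma> (Elim u (Arg t)) C"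
inductive_cases typing_TArgE: "typing L n \<Gamma> (Elim u (TArg m)) C"
inductive_cases typing_Proj0E: "typing L n \<Gamma> (Elim u Proj0) C"
inductive_cases typing_Proj1E: "typing L n \<Gamma> (Elim u Proj1) C"
inductive_cases typing_CaseE: "typing L n \<Gamma> (Elim u (Case A v B w)) C"
inductive_cases typing_UnpackE: "typing L n \<Gamma> (Elim u (Unpack A v)) C"

lemma typing_ilift:
  "typing L n \<Gamma> t A \<Longrightarrow> k \<le> n \<Longrightarrow>
     typing L (Suc n) (map (lift_fm k) \<Gamma>) (ilift k t) (lift_fm k A)"
proof (induction arbitrary: k rule: typing.induct)
  case (Free A n \<Gamma> x)
  then show ?case by (simp add: lift_wf_fm typing.Free)
next
  case (Bound i \<Gamma> n)
  then show ?case by (metis ilift.simps(2) length_map nth_map typing.Bound)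
next
  case (Arg n \<Gamma> t A B u)
  then show ?case by (simp add: typing.Arg[of L "Suc n" _ _ "lift_fm k A"])
next
  case (TLam n \<Gamma> u A)
  then have "typing L (Suc (Suc n)) (map (lift_fm (Suc k)) (map (lift_fm 0) \<Gamma>))
      (ilift (Suc k) u) (lift_fm (Suc k) A)" by simp
  then show ?case by (simp add: typing.TLam lift_lift_fm comp_def)
next
  case (TArg n \<Gamma> u A m)
  then show ?case by (simp add: typing.TArg lift_subst_fm wf_lift_trm)
next
  case (Wit n A m \<Gamma> u)
  then show ?case
    using wf_lift_fm[of L "Suc n" A "Suc k"] by (simp add: typing.Wit lift_subst_fm wf_lift_trm)
next
  case (Unpack n \<Gamma> u A t C)
  then have "typing L (Suc (Suc n)) (map (lift_fm (Suc k)) (A # map (lift_fm 0) \<Gamma>))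
      (ilift (Suc k) t) (lift_fm (Suc k) (lift_fm 0 C))" by simp
  with Unpack show ?case by (simp add: typing.Unpack lift_lift_fm comp_def)
qed (auto intro: typing.intros simp: wf_lift_fm)

lemma typing_isubst:
  "typing L N \<Gamma> t A \<Longrightarrow> N = Suc n \<Longrightarrow> wf_trm L n m \<Longrightarrow> k \<le> n \<Longrightarrow>
     typing L n (map (subst_fm k m) \<Gamma>) (isubst k m t) (subst_fm k m A)"
proof (induction arbitrary: n k m rule: typing.induct)
  case (Free A N \<Gamma> x)
  then show ?case by (simp add: subst_wf_fm typing.Free)
next
  case (Bound i \<Gamma> N)
  then show ?case by (metis isubst.simps(2) length_map nth_map typing.Bound)
next
  case (Arg N \<Gamma> t A B u)
  then show ?case by (simp add: typing.Arg[of L n _ _ "subst_fm k m A"])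
next
  case (TLam N \<Gamma> u A)
  then have "typing L (Suc n) (map (subst_fm (Suc k) (lift_trm 0 m)) (map (lift_fm 0) \<Gamma>))
      (isubst (Suc k) (lift_trm 0 m) u) (subst_fm (Suc k) (lift_trm 0 m) A)"
    by (simp add: wf_lift_trm)
  then show ?case by (simp add: typing.TLam subst_lift_comm_fm comp_def)
next
  case (TArg N \<Gamma> u A m')
  then show ?case by (simp add: typing.TArg subst_subst_fm[of 0 k] wf_subst_trm)
next
  case (Wit N A m' \<Gamma> u)
  then show ?case
    using Wit.IH[OF Wit.prems] wf_subst_fm[of L "Suc n" A "lift_trm 0 m" "Suc k"]
    by (simp add: typing.Wit subst_subst_fm[of 0 k] wf_subst_trm wf_lift_trm)
next
  case (Unpack N \<Gamma> u A t C)
  then have "typing L (Suc n)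
      (map (subst_fm (Suc k) (lift_trm 0 m)) (A # map (lift_fm 0) \<Gamma>))
      (isubst (Suc k) (lift_trm 0 m) t) (subst_fm (Suc k) (lift_trm 0 m) (lift_fm 0 C))"
    by (simp add: wf_lift_trm)
  with Unpack show ?case by (simp add: typing.Unpack subst_lift_comm_fm comp_def)
qed (auto intro: typing.intros simp: wf_subst_fm)

lemma typing_plift:
  "typing L n \<Gamma> t A \<Longrightarrow> \<Gamma> = \<Delta> @ \<Theta> \<Longrightarrow> typing L n (\<Delta> @ B # \<Theta>) (plift (length \<Delta>) t) A"
proof (induction arbitrary: \<Delta> \<Theta> B rule: typing.induct)
  case (Bound i \<Gamma> n)
  show ?case
  proof (cases "i < length \<Delta>")
    case True
    then show ?thesis
      using typing.Bound[of i "\<Delta> @ B # \<Theta>" L n] Bound by (simp add: nth_append)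
  next
    case False
    then show ?thesis
      using typing.Bound[of "Suc i" "\<Delta> @ B # \<Theta>" L n] Bound
      by (simp add: nth_append Suc_diff_le)
  qed
next
  case (Lam n A \<Gamma> u B')
  then show ?case using Lam.IH[of "A # \<Delta>" \<Theta> B] by (simp add: typing.Lam)
next
  case (Arg n \<Gamma> t A' B' u)
  then show ?case by (simp add: typing.Arg[of L n _ _ A'])
next
  case (Case n \<Gamma> u A1 A2 w1 C w2)
  then show ?case using Case.IH(2)[of "A1 # \<Delta>" \<Theta> B] Case.IH(3)[of "A2 # \<Delta>" \<Theta> B]
    by (simp add: typing.Case)
next
  case (TLam n \<Gamma> u A)
  then show ?case
    using TLam.IH[of "map (lift_fm 0) \<Delta>" "map (lift_fm 0) \<Theta>" "lift_fm 0 B"]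
    by (simp add: typing.TLam)
next
  case (Unpack n \<Gamma> u A t C)
  then show ?case
    using Unpack.IH(2)[of "A # map (lift_fm 0) \<Delta>" "map (lift_fm 0) \<Theta>" "lift_fm 0 B"]
    by (simp add: typing.Unpack)
next
  case (Par n A1 A2 \<Gamma> u C v)
  then show ?case
    using Par.IH(1)[of "Imp A1 A2 # \<Delta>" \<Theta> B] Par.IH(2)[of "Imp A2 A1 # \<Delta>" \<Theta> B]
    by (simp add: typing.Par)
next
  case (Proj0 n \<Gamma> u A1 A2)
  then show ?case by (simp add: typing.Proj0[of L n _ _ A1 A2])
next
  case (Proj1 n \<Gamma> u A1 A2)
  then show ?case by (simp add: typing.Proj1[of L n _ _ A1 A2])
qed (simp_all add: typing.intros)

lemma typing_plift_0: "typing L n \<Gamma> t A \<Longrightarrow> typing L n (B # \<Gamma>) (plift 0 t) A"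
  using typing_plift[of L n \<Gamma> t A "[]"] by simp

lemma typing_psubst:
  "typing L n \<Gamma> u A \<Longrightarrow> \<Gamma> = \<Delta> @ B # \<Theta> \<Longrightarrow> typing L n (\<Delta> @ \<Theta>) t B \<Longrightarrow>
     typing L n (\<Delta> @ \<Theta>) (psubst (length \<Delta>) t u) A"
proof (induction arbitrary: \<Delta> \<Theta> B t rule: typing.induct)
  case (Bound i \<Gamma> n)
  consider "i < length \<Delta>" | "i = length \<Delta>" | "length \<Delta> < i" by linarith
  then show ?case
  proof cases
    case 1
    then show ?thesis
      using typing.Bound[of i "\<Delta> @ \<Theta>" L n] Bound by (simp add: nth_append)
  next
    case 2
    then show ?thesis using Bound by simp
  next
    case 3
    then obtain j where "i = Suc j" "length \<Delta> \<le> j" by (cases i) auto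
    then show ?thesis
      using typing.Bound[of j "\<Delta> @ \<Theta>" L n] Bound by (simp add: nth_append Suc_diff_le)
  qed
next
  case (Lam n A \<Gamma> u B')
  then show ?case using Lam.IH[of "A # \<Delta>" B \<Theta> "plift 0 t"]
    by (simp add: typing.Lam typing_plift_0)
next
  case (Arg n \<Gamma> u A' B' v)
  then show ?case by (simp add: typing.Arg[of L n _ _ A'])
next
  case (Case n \<Gamma> u A1 A2 w1 C w2)
  then show ?case
    using Case.IH(2)[of "A1 # \<Delta>" B \<Theta> "plift 0 t"] Case.IH(3)[of "A2 # \<Delta>" B \<Theta> "plift 0 t"]
    by (simp add: typing.Case typing_plift_0)
next
  case (TLam n \<Gamma> u A)
  then show ?case
    using TLam.IH[of "map (lift_fm 0) \<Delta>" "lift_fm 0 B" "map (lift_fm 0) \<Theta>" "ilift 0 t"]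
      typing_ilift[OF TLam.prems(2), of 0]
    by (simp add: typing.TLam)
next
  case (Unpack n \<Gamma> u A w C)
  then show ?case
    using typing_ilift[OF Unpack.prems(2), of 0]
      Unpack.IH(2)[of "A # map (lift_fm 0) \<Delta>" "lift_fm 0 B" "map (lift_fm 0) \<Theta>"
        "plift 0 (ilift 0 t)"]
    by (simp add: typing.Unpack typing_plift_0)
next
  case (Par n A1 A2 \<Gamma> u C v)
  then show ?case
    using Par.IH(1)[of "Imp A1 A2 # \<Delta>" B \<Theta> "plift 0 t"]
      Par.IH(2)[of "Imp A2 A1 # \<Delta>" B \<Theta> "plift 0 t"]
    by (simp add: typing.Par typing_plift_0)
next
  case (Proj0 n \<Gamma> u A1 A2)
  then show ?case by (simp add: typing.Proj0[of L n _ _ A1 A2])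
next
  case (Proj1 n \<Gamma> u A1 A2)
  then show ?case by (simp add: typing.Proj1[of L n _ _ A1 A2])
qed (simp_all add: typing.intros)

lemma typing_psubst_0:
  "typing L n (B # \<Gamma>) u A \<Longrightarrow> typing L n \<Gamma> t B \<Longrightarrow> typing L n \<Gamma> (psubst 0 t u) A"
  using typing_psubst[of L n "B # \<Gamma>" u A "[]"] by simp

lemma typing_isubst_0:
  "typing L (Suc n) (map (lift_fm 0) \<Gamma>) u A \<Longrightarrow> wf_trm L n m \<Longrightarrow>
     typing L n \<Gamma> (isubst 0 m u) (subst_fm 0 m A)"
  using typing_isubst[of L "Suc n" "map (lift_fm 0) \<Gamma>" u A n m 0] by (simp add: comp_def)

lemma typing_plift_1_funpow:
  assumes "typing L n (B # \<Theta>) v D"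
  shows "typing L n (B # \<Delta> @ \<Theta>) ((plift 1 ^^ length \<Delta>) v) D"
proof (induction \<Delta>)
  case Nil
  from assms show ?case by simp
next
  case (Cons E \<Delta>)
  then have "typing L n ([B] @ \<Delta> @ \<Theta>) ((plift 1 ^^ length \<Delta>) v) D" by simp
  from typing_plift[OF this refl, of E] show ?case by simp
qed

lemma typing_transmit:
  assumes "typing L n (Imp B A # \<Gamma>) v D" and "typing L n (\<Delta> @ \<Gamma>) u A" and "wf_fm L n B"
    and "length \<Delta> = Suc d"
  shows "typing L n (\<Delta> @ \<Gamma>) (transmit d B u v) D"
  unfolding transmit_def
proof (rule typing_psubst_0)
  show "typing L n (Imp B A # \<Delta> @ \<Gamma>) ((plift 1 ^^ Suc d) v) D"
    using typing_plift_1_funpow[OF assms(1), of \<Delta>] unfolding assms(4) .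
  show "typing L n (\<Delta> @ \<Gamma>) (Lam B (plift 0 u)) (Imp B A)"
    by (intro typing.Lam typing_plift_0 assms)
qed


section \<open>Subject reduction\<close>

lemma app_stack_Nil [simp]: "t \<bullet> [] = t"
  and app_stack_Cons [simp]: "t \<bullet> (\<xi> # \<sigma>) = Elim t \<xi> \<bullet> \<sigma>"
  by (simp_all add: app_stack_def)

lemma typing_app_stackD: "typing L n \<Gamma> (t \<bullet> \<sigma>) D \<Longrightarrow> \<exists>E. typing L n \<Gamma> t E"
proof (induction \<sigma> arbitrary: t)
  case (Cons \<xi> \<sigma>)
  then obtain E where "typing L n \<Gamma> (Elim t \<xi>) E" by auto
  then show ?case by (auto elim: typing_ElimE)
qed auto

lemma typing_Elim_mono:
  assumes "typing L n \<Gamma> (Elim t \<xi>) D" and "\<And>E. typing L n \<Gamma> t E \<Longrightarrow> typing L n \<Gamma> t' E"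
  shows "typing L n \<Gamma> (Elim t' \<xi>) D"
  using assms(1) by (cases rule: typing_ElimE) (auto intro: typing.intros assms(2))

lemma typing_app_stack_mono:
  assumes "typing L n \<Gamma> (t \<bullet> \<sigma>) D" and "\<And>E. typing L n \<Gamma> t E \<Longrightarrow> typing L n \<Gamma> t' E"
  shows "typing L n \<Gamma> (t' \<bullet> \<sigma>) D"
  using assms
proof (induction \<sigma> arbitrary: t t')
  case (Cons \<xi> \<sigma>)
  show ?case
    using Cons.IH[of "Elim t \<xi>" "Elim t' \<xi>"] Cons.prems typing_Elim_mono by force
qed auto

lemma hole_types_append: "\<exists>\<Delta>. hole_types \<Gamma> C = \<Delta> @ \<Gamma> \<and> length \<Delta> = depth C"
proof (induction C arbitrary: \<Gamma>)
  case (ParL A B C v)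
  from ParL[of "Imp A B # \<Gamma>"] show ?case by (metis append.assoc append_Cons append_Nil
      depth.simps(2) hole_types.simps(2) length_append_singleton)
next
  case (ParR A B u C)
  from ParR[of "Imp B A # \<Gamma>"] show ?case by (metis append.assoc append_Cons append_Nil
      depth.simps(3) hole_types.simps(3) length_append_singleton)
qed simp

lemma typing_plugD: "typing L n \<Gamma> (plug C t) D \<Longrightarrow> typing L n (hole_types \<Gamma> C) t D"
  by (induction C arbitrary: \<Gamma>) (auto elim: typing_ParE)

lemma typing_plug_mono:
  "typing L n \<Gamma> (plug C t) D \<Longrightarrow> typing L n (hole_types \<Gamma> C) t' D \<Longrightarrow> typing L n \<Gamma> (plug C t') D"
  by (induction C arbitrary: \<Gamma>) (auto elim!: typing_ParE intro: typing.Par)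

lemma typing_transmit_plug:
  assumes "typing L n (Imp A B # \<Gamma>) (plug C (Elim (Bound (depth C)) (Arg u) \<bullet> \<sigma>)) D"
    and "typing L n (Imp B A # \<Gamma>) v D" and "wf_fm L n B"
  shows "typing L n (Imp A B # \<Gamma>) (plug C (transmit (depth C) B u v)) D"
proof (rule typing_plug_mono[OF assms(1)])
  from hole_types_append
  obtain \<Delta> where \<Delta>: "hole_types (Imp A B # \<Gamma>) C = \<Delta> @ Imp A B # \<Gamma>" "length \<Delta> = depth C"
    by blast
  have nth: "hole_types (Imp A B # \<Gamma>) C ! depth C = Imp A B"
    unfolding \<Delta>(1) \<Delta>(2)[symmetric] by simp
  obtain E where "typing L n (hole_types (Imp A B # \<Gamma>) C) (Elim (Bound (depth C)) (Arg u)) E"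
    using typing_app_stackD[OF typing_plugD[OF assms(1)]] by blast
  then have "typing L n (hole_types (Imp A B # \<Gamma>) C) u A"
    by (auto simp: nth elim!: typing_ArgE typing_BoundE)
  then have "typing L n ((\<Delta> @ [Imp A B]) @ \<Gamma>) u A" using \<Delta>(1) by simp
  from typing_transmit[OF assms(2) this assms(3)]
  show "typing L n (hole_types (Imp A B # \<Gamma>) C) (transmit (depth C) B u v) D"
    using \<Delta> by simp
qed

lemma typing_plift_1:
  assumes "typing L n (A # \<Gamma>) t D"
  shows "typing L n (A # B # \<Gamma>) (plift (Suc 0) t) D"
proof -
  from assms have "typing L n ([A] @ \<Gamma>) t D" by simp
  from typing_plift[OF this refl, of B] show ?thesis by simp
qed

lemma typing_Elim_plift:
  assumes "typing L n \<Gamma> (Elim t \<xi>) D"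
  shows "\<exists>E. typing L n \<Gamma> t E \<and>
    (\<forall>t' B. typing L n (B # \<Gamma>) t' E \<longrightarrow> typing L n (B # \<Gamma>) (Elim t' (plift_elem 0 \<xi>)) D)"
  using assms
proof (cases \<xi>)
  case (Case A w1 B w2)
  with assms have "typing L n \<Gamma> t (Disj A B)" "typing L n (A # \<Gamma>) w1 D" "typing L n (B # \<Gamma>) w2 D"
    by (auto elim: typing_CaseE)
  with Case show ?thesis by (auto intro!: exI[of _ "Disj A B"] typing.Case typing_plift_1)
next
  case (Unpack A w)
  with assms have "typing L n \<Gamma> t (Exists A)"
    "typing L (Suc n) (A # map (lift_fm 0) \<Gamma>) w (lift_fm 0 D)"
    by (auto elim: typing_UnpackE)
  with Unpack show ?thesis by (auto intro!: exI[of _ "Exists A"] typing.Unpack typing_plift_1)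
next
  case (Arg u)
  with assms show ?thesis by (auto elim!: typing_ArgE) (blast intro: typing.Arg typing_plift_0)
next
  case (TArg m)
  with assms show ?thesis by (auto elim!: typing_TArgE) (blast intro: typing.TArg)
next
  case Proj0
  with assms show ?thesis by (auto elim!: typing_Proj0E) (blast intro: typing.Proj0)
next
  case Proj1
  with assms show ?thesis by (auto elim!: typing_Proj1E) (blast intro: typing.Proj1)
qed

lemma typing_permute:
  assumes "typing L n \<Gamma> (Elim (Par A B u v) \<xi>) D"
  shows "typing L n \<Gamma> (Par A B (Elim u (plift_elem 0 \<xi>)) (Elim v (plift_elem 0 \<xi>))) D"
  using typing_Elim_plift[OF assms] by (blast elim: typing_ParE intro: typing.Par)

lemma has_abort_app_stack: "has_abort (t \<bullet> \<sigma>) \<longleftrightarrow> has_abort t \<or> (\<exists>\<xi>\<in>set \<sigma>. has_abort_elem \<xi>)"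
  by (induction \<sigma> arbitrary: t) auto

lemma subject_reduction_basic:
  assumes "basic L \<Gamma> h h'" and "typing L 0 \<Gamma> h D" and "\<not> has_abort h"
  shows "typing L 0 \<Gamma> h' D"
  using assms
proof (induction rule: basic.induct)
  case (beta A u t)
  then show ?case by (auto elim!: typing_ArgE typing_LamE intro: typing_psubst_0)
next
  case (inst u m)
  then show ?case by (auto elim!: typing_TArgE typing_TLamE intro: typing_isubst_0)
next
  case (case0 D u A t0 B t1)
  then show ?case by (auto elim!: typing_CaseE typing_Inj0E intro: typing_psubst_0)
next
  case (case1 D u A t0 B t1)
  then show ?case by (auto elim!: typing_CaseE typing_Inj1E intro: typing_psubst_0)
next
  case (unpack A m u B v)
  then have v: "typing L (Suc 0) (A # map (lift_fm 0) \<Gamma>) v (lift_fm 0 D)" and m: "wf_trm L 0 m"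
    and u: "typing L 0 \<Gamma> u (subst_fm 0 m A)" and "A = B"
    by (auto elim!: typing_UnpackE typing_WitE)
  from typing_isubst[OF v refl m, of 0] u show ?case
    by (auto simp: comp_def intro: typing_psubst_0)
next
  case (permute A B u v \<xi>)
  then show ?case by (blast intro: typing_permute)
next
  case (comm_left A B C u \<sigma> v)
  then show ?case by (blast elim: typing_ParE intro: typing.Par typing_transmit_plug)
next
  case (comm_right A B v C u \<sigma>)
  then show ?case by (blast elim: typing_ParE intro: typing.Par typing_transmit_plug)
next
  case (abort A B u \<sigma> D)
  then show ?case by (simp add: has_abort_app_stack)
qed (auto elim!: typing_Proj0E typing_Proj1E typing_TupleE)


section \<open>Preservation of closedness and of the absence of aborts\<close>

lemma
  fixes t :: "('f, 'p) pterm" and \<xi> :: "('f, 'p) elem"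
  shows has_abort_ilift [simp]: "has_abort (ilift k t) = has_abort t"
  and has_abort_elem_ilift [simp]: "has_abort_elem (ilift_elem k \<xi>) = has_abort_elem \<xi>"
  by (induction t and \<xi> arbitrary: k and k rule: pterm.induct elem.induct) auto

lemma
  fixes t :: "('f, 'p) pterm" and \<xi> :: "('f, 'p) elem"
  shows has_abort_plift [simp]: "has_abort (plift k t) = has_abort t"
  and has_abort_elem_plift [simp]: "has_abort_elem (plift_elem k \<xi>) = has_abort_elem \<xi>"
  by (induction t and \<xi> arbitrary: k and k rule: pterm.induct elem.induct) auto

lemma
  fixes t :: "('f, 'p) pterm" and \<xi> :: "('f, 'p) elem"
  shows has_abort_isubst [simp]: "has_abort (isubst k m t) = has_abort t"
  and has_abort_elem_isubst [simp]: "has_abort_elem (isubst_elem k m \<xi>) = has_abort_elem \<xi>"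
  by (induction t and \<xi> arbitrary: k m and k m rule: pterm.induct elem.induct) auto

lemma
  fixes t :: "('f, 'p) pterm" and \<xi> :: "('f, 'p) elem"
  shows has_abort_psubst: "has_abort (psubst k s t) \<Longrightarrow> has_abort s \<or> has_abort t"
  and has_abort_elem_psubst: "has_abort_elem (psubst_elem k s \<xi>) \<Longrightarrow> has_abort s \<or> has_abort_elem \<xi>"
  by (induction t and \<xi> arbitrary: k s and k s rule: pterm.induct elem.induct)
    (auto split: if_splits, (force split: if_splits)+)

lemma
  fixes t :: "('f, 'p) pterm" and \<xi> :: "('f, 'p) elem"
  shows free_pvars_ilift [simp]: "free_pvars (ilift k t) = free_pvars t"
  and free_pvars_elem_ilift [simp]: "free_pvars_elem (ilift_elem k \<xi>) = free_pvars_elem \<xi>"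
  by (induction t and \<xi> arbitrary: k and k rule: pterm.induct elem.induct) auto

lemma
  fixes t :: "('f, 'p) pterm" and \<xi> :: "('f, 'p) elem"
  shows free_pvars_plift [simp]: "free_pvars (plift k t) = free_pvars t"
  and free_pvars_elem_plift [simp]: "free_pvars_elem (plift_elem k \<xi>) = free_pvars_elem \<xi>"
  by (induction t and \<xi> arbitrary: k and k rule: pterm.induct elem.induct) auto

lemma
  fixes t :: "('f, 'p) pterm" and \<xi> :: "('f, 'p) elem"
  shows free_pvars_isubst [simp]: "free_pvars (isubst k m t) = free_pvars t"
  and free_pvars_elem_isubst [simp]: "free_pvars_elem (isubst_elem k m \<xi>) = free_pvars_elem \<xi>"
  by (induction t and \<xi> arbitrary: k m and k m rule: pterm.induct elem.induct) auto

lemma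
  fixes t :: "('f, 'p) pterm" and \<xi> :: "('f, 'p) elem"
  shows free_pvars_psubst: "free_pvars (psubst k s t) \<subseteq> free_pvars s \<union> free_pvars t"
  and free_pvars_elem_psubst:
    "free_pvars_elem (psubst_elem k s \<xi>) \<subseteq> free_pvars s \<union> free_pvars_elem \<xi>"
  by (induction t and \<xi> arbitrary: k s and k s rule: pterm.induct elem.induct)
    (auto, (fastforce)+)

definition clean :: "('f, 'p) pterm \<Rightarrow> bool" where
  "clean t \<longleftrightarrow> free_pvars t = {} \<and> \<not> has_abort t"

lemma clean_psubst: "clean s \<Longrightarrow> clean t \<Longrightarrow> clean (psubst k s t)"
  unfolding clean_def using has_abort_psubst free_pvars_psubst by blast

lemma clean_plift: "clean (plift k t) = clean t"
  by (simp add: clean_def)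

lemma clean_transmit: "clean u \<Longrightarrow> clean v \<Longrightarrow> clean (transmit d B u v)"
proof -
  have "clean ((plift 1 ^^ n) v) = clean v" for n by (induction n) (auto simp: clean_plift)
  moreover assume "clean u" "clean v"
  ultimately show ?thesis
    unfolding transmit_def by (intro clean_psubst) (auto simp: clean_def)
qed

lemma clean_app_stack:
  "clean (t \<bullet> \<sigma>) \<longleftrightarrow> clean t \<and> (\<forall>\<xi>\<in>set \<sigma>. free_pvars_elem \<xi> = {} \<and> \<not> has_abort_elem \<xi>)"
  by (induction \<sigma> arbitrary: t) (auto simp: clean_def)

lemma clean_Par [simp]: "clean (Par A B u v) \<longleftrightarrow> clean u \<and> clean v"
  by (auto simp: clean_def)

lemma clean_plugD: "clean (plug C t) \<Longrightarrow> clean t"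
  by (induction C) auto

lemma clean_plug_mono: "clean (plug C t) \<Longrightarrow> clean t' \<Longrightarrow> clean (plug C t')"
  by (induction C) auto

lemma clean_transmit_plug:
  assumes "clean (plug C (Elim (Bound (depth C)) (Arg u) \<bullet> \<sigma>))" and "clean v"
  shows "clean (plug C (transmit d B u v))"
proof (rule clean_plug_mono[OF assms(1) clean_transmit[OF _ assms(2)]])
  show "clean u"
    using clean_plugD[OF assms(1)] by (auto simp: clean_app_stack) (auto simp: clean_def)
qed

lemma clean_basic: "basic L \<Gamma> h h' \<Longrightarrow> clean h \<Longrightarrow> clean h'"
proof (induction rule: basic.induct)
  case (abort A B u \<sigma> D)
  then show ?case by (simp add: clean_def has_abort_app_stack)
next
  case (unpack A m u B v)
  then show ?case by (intro clean_psubst) (auto simp: clean_def)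
qed (auto intro: clean_transmit_plug, auto simp: clean_def dest!: has_abort_psubst
      free_pvars_psubst[THEN subsetD])

lemma head_redex_eq: "head_redex L \<Gamma> p h \<sigma> \<Longrightarrow> p = h \<bullet> \<sigma>"
  by (induction rule: head_redex.induct) auto

lemma head_step_preserves:
  assumes "head_step L t t'" and "has_type L t D" and "clean t"
  shows "has_type L t' D \<and> clean t'"
proof -
  obtain C h \<sigma> h' where t: "t = plug C (h \<bullet> \<sigma>)" and h': "basic L (hole_types [] C) h h'"
    and t': "t' = plug C (h' \<bullet> \<sigma>)"
    using assms(1) unfolding head_step_def process_redex_def by (blast dest: head_redex_eq)
  have cl: "clean (h \<bullet> \<sigma>)" using assms(3) clean_plugD t by blast
  then have "clean h" "clean (h' \<bullet> \<sigma>)" using clean_basic[OF h'] by (auto simp: clean_app_stack)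
  moreover have "typing L 0 (hole_types [] C) (h' \<bullet> \<sigma>) D"
    using typing_plugD[of L 0 "[]" C "h \<bullet> \<sigma>" D] assms(2) t
      typing_app_stack_mono subject_reduction_basic[OF h'] \<open>clean h\<close>
    unfolding clean_def by metis
  ultimately show ?thesis
    using assms t t' typing_plug_mono clean_plug_mono by metis
qed

lemma head_steps_preserve:
  "(head_step L)\<^sup>*\<^sup>* t t' \<Longrightarrow> has_type L t D \<Longrightarrow> clean t \<Longrightarrow> has_type L t' D \<and> clean t'"
  by (induction rule: rtranclp_induct) (use head_step_preserves in blast)+


section \<open>Head normal forms of existential type\<close>

lemma redex_if_head_redex: "head_redex L \<Gamma> p h \<sigma> \<Longrightarrow> redex L \<Gamma> h"
  by (induction rule: head_redex.induct) (auto simp: redex_def intro: basic.abort)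

lemma head_normal_no_redex:
  assumes "head_normal L (plug C p)"
  shows "\<not> head_redex L (hole_types [] C) p h \<sigma>"
proof
  let ?P = "\<lambda>(C', h, \<sigma>). process_redex L (plug C p) C' h \<sigma>"
  let ?m = "\<lambda>(C', h, \<sigma>). procs_before C' + start h"
  assume "head_redex L (hole_types [] C) p h \<sigma>"
  then have "?P (C, h, \<sigma>)" unfolding process_redex_def by auto
  from ex_has_least_nat[of ?P, OF this, of ?m]
  obtain C' h1 \<sigma>1 where min: "process_redex L (plug C p) C' h1 \<sigma>1"
    "\<forall>C2 h2 \<sigma>2. process_redex L (plug C p) C2 h2 \<sigma>2 \<longrightarrow>
       procs_before C' + start h1 \<le> procs_before C2 + start h2"
    by fastforce
  then obtain h' where "basic L (hole_types [] C') h1 h'"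
    unfolding process_redex_def using redex_if_head_redex unfolding redex_def by blast
  with min have "head_step L (plug C p) (plug C' (h' \<bullet> \<sigma>1))"
    unfolding head_step_def by blast
  with assms show False unfolding head_normal_def by blast
qed

lemma pterm_spine: "\<exists>h \<sigma>. p = h \<bullet> \<sigma> \<and> (\<forall>t \<xi>. h \<noteq> Elim t \<xi>)"
proof (induction p rule: measure_induct_rule[of size])
  case (less p)
  show ?case
  proof (cases "\<exists>t \<xi>. p = Elim t \<xi>")
    case True
    then obtain t \<xi> where p: "p = Elim t \<xi>" by blast
    then obtain h \<sigma> where h: "t = h \<bullet> \<sigma>" "\<forall>t \<xi>. h \<noteq> Elim t \<xi>" using less[of t] by auto
    then have "p = h \<bullet> (\<sigma> @ [\<xi>])" using p by (simp add: app_stack_def)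
    with h show ?thesis by blast
  next
    case False
    then have "p = p \<bullet> []" "\<forall>t \<xi>. p \<noteq> Elim t \<xi>" by auto
    then show ?thesis by blast
  qed
qed

lemma hole_types_Imp: "E \<in> set (hole_types \<Gamma> C) \<Longrightarrow> E \<in> set \<Gamma> \<or> (\<exists>A B. E = Imp A B)"
  by (induction C arbitrary: \<Gamma>) fastforce+

lemma length_hole_types: "length (hole_types \<Gamma> C) = depth C + length \<Gamma>"
  by (induction C arbitrary: \<Gamma>) auto

text \<open>The parallel composition in \<open>C\<close> that binds index \<open>i\<close> at the hole.\<close>

lemma pctx_split:
  "i < depth C \<Longrightarrow> \<exists>C1 A B C2 w. depth C2 = i \<and>
     ((\<forall>t. plug C t = plug C1 (Par A B (plug C2 t) w)) \<or>
      (\<forall>t. plug C t = plug C1 (Par A B w (plug C2 t))))"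
proof (induction C)
  case (ParL A B C v)
  show ?case
  proof (cases "i < depth C")
    case True
    with ParL.IH obtain C1 A' B' C2 w where "depth C2 = i"
      "(\<forall>t. plug C t = plug C1 (Par A' B' (plug C2 t) w)) \<or>
       (\<forall>t. plug C t = plug C1 (Par A' B' w (plug C2 t)))" by blast
    then show ?thesis
      by (intro exI[of _ "ParL A B C1 v"] exI[of _ A'] exI[of _ B'] exI[of _ C2] exI[of _ w]) auto
  next
    case False
    with ParL.prems have "depth C = i" by simp
    then show ?thesis by (metis plug.simps(1,2))
  qed
next
  case (ParR A B v C)
  show ?case
  proof (cases "i < depth C")
    case True
    with ParR.IH obtain C1 A' B' C2 w where "depth C2 = i"
      "(\<forall>t. plug C t = plug C1 (Par A' B' (plug C2 t) w)) \<or>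
       (\<forall>t. plug C t = plug C1 (Par A' B' w (plug C2 t)))" by blast
    then show ?thesis
      by (intro exI[of _ "ParR A B v C1"] exI[of _ A'] exI[of _ B'] exI[of _ C2] exI[of _ w]) auto
  next
    case False
    with ParR.prems have "depth C = i" by simp
    then show ?thesis by (metis plug.simps(1,3))
  qed
qed simp

lemma head_normal_no_comm:
  assumes "i < depth C"
  shows "\<not> head_normal L (plug C (Elim (Bound i) (Arg s) \<bullet> \<sigma>))"
proof -
  let ?p = "Elim (Bound i) (Arg s) \<bullet> \<sigma>"
  obtain C1 A B C2 w where i: "depth C2 = i" and
    "(\<forall>t. plug C t = plug C1 (Par A B (plug C2 t) w)) \<or>
     (\<forall>t. plug C t = plug C1 (Par A B w (plug C2 t)))"
    using pctx_split[OF assms] by blast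
  then obtain q r where "plug C ?p = plug C1 (Par A B q r)"
    and "redex L (hole_types [] C1) (Par A B q r)"
    unfolding redex_def using basic.comm_left basic.comm_right by metis
  then show ?thesis using head_normal_no_redex head_redex.par by metis
qed

lemma redexI: "basic L \<Gamma> h h' \<Longrightarrow> redex L \<Gamma> h"
  by (auto simp: redex_def)

lemmas elim_redexI = basic.beta[THEN redexI] basic.inst[THEN redexI] basic.proj0[THEN redexI]
  basic.proj1[THEN redexI] basic.case0[THEN redexI] basic.case1[THEN redexI]
  basic.unpack[THEN redexI] basic.permute[THEN redexI]

lemmas typing_introE = typing_TupleE typing_LamE typing_TLamE typing_Inj0E typing_Inj1E typing_WitE
lemmas typing_elimE = typing_ArgE typing_TArgE typing_Proj0E typing_Proj1E typing_CaseE typing_UnpackE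

lemma redex_if_head_former:
  assumes "head_former h" and "typing L n \<Gamma> (Elim h \<xi>) D"
  shows "redex L \<Gamma> (Elim h \<xi>)"
  using assms
  by (cases h; cases \<xi>) (auto intro: elim_redexI elim!: typing_elimE elim: typing_introE)

lemma head_normal_process:
  assumes "head_normal L (plug C p)" and "has_type L (plug C p) (Exists A)" and "clean p"
    and "\<And>A' B u v. p \<noteq> Par A' B u v"
  shows "\<exists>m v. p = Wit A m v"
proof -
  let ?\<Gamma> = "hole_types [] C"
  obtain h \<sigma> where p: "p = h \<bullet> \<sigma>" and h: "\<forall>t \<xi>. h \<noteq> Elim t \<xi>" using pterm_spine by blast
  have ty: "typing L 0 ?\<Gamma> (h \<bullet> \<sigma>) (Exists A)" using typing_plugD assms(2) p by blast
  have "clean h" using assms(3) p by (simp add: clean_app_stack)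
  show ?thesis
  proof (cases \<sigma>)
    case Nil
    then have ty: "typing L 0 ?\<Gamma> h (Exists A)" and "p = h" using ty p by auto
    show ?thesis
    proof (cases h)
      case (Bound i)
      with ty have "Exists A \<in> set ?\<Gamma>" by (auto elim!: typing_BoundE)
      then show ?thesis using hole_types_Imp by fastforce
    qed (use ty \<open>clean h\<close> \<open>p = h\<close> h assms(4) in \<open>auto simp: clean_def elim: typing_introE typing_EfqE\<close>)
  next
    case (Cons \<xi> \<tau>)
    with ty obtain E where E: "typing L 0 ?\<Gamma> (Elim h \<xi>) E"
      using typing_app_stackD[of L 0 ?\<Gamma> "Elim h \<xi>" \<tau>] by auto
    have "\<not> head_former h"
      using redex_if_head_former[OF _ E] head_redex.elim head_normal_no_redex[OF assms(1)] p Cons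
      by fastforce
    then consider i where "h = Bound i" | P u where "h = Efq P u"
      using h \<open>clean h\<close> by (cases h) (auto simp: clean_def)
    then show ?thesis
    proof cases
      case 1
      with E obtain F where "typing L 0 ?\<Gamma> (Bound i) F" by (auto elim: typing_ElimE)
      then have i: "i < length ?\<Gamma>" by (auto elim: typing_BoundE)
      then have "?\<Gamma> ! i \<in> set ?\<Gamma>" by simp
      then obtain A' B' where "?\<Gamma> ! i = Imp A' B'" using hole_types_Imp by fastforce
      with E 1 obtain s where "\<xi> = Arg s" by (auto elim!: typing_ElimE typing_BoundE)
      then have "p = Elim (Bound i) (Arg s) \<bullet> \<tau>" using p Cons 1 by simp
      then show ?thesis using head_normal_no_comm assms(1) i by (metis add_0_right length_hole_types list.size(3))
    next
      case 2
      then show ?thesis using E by (auto elim!: typing_ElimE typing_EfqE)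
    qed
  qed
qed

lemma pctx_extend:
  "\<exists>C'. \<forall>t. plug C' t = plug C (Par A B t v)" "\<exists>C'. \<forall>t. plug C' t = plug C (Par A B u t)"
proof -
  show "\<exists>C'. \<forall>t. plug C' t = plug C (Par A B t v)"
  proof (induction C)
    case Hole
    show ?case by (rule exI[of _ "ParL A B Hole v"]) simp
  qed (metis plug.simps(2,3))+
  show "\<exists>C'. \<forall>t. plug C' t = plug C (Par A B u t)"
  proof (induction C)
    case Hole
    show ?case by (rule exI[of _ "ParR A B u Hole"]) simp
  qed (metis plug.simps(2,3))+
qed

lemma herbrand_nf_process:
  "head_normal L (plug C p) \<Longrightarrow> has_type L (plug C p) (Exists A) \<Longrightarrow> clean p \<Longrightarrow> herbrand_nf p"
proof (induction p arbitrary: C rule: procs.induct)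
  case (1 A' B u v)
  obtain C1 C2 where "plug C1 u = plug C (Par A' B u v)" "plug C2 v = plug C (Par A' B u v)"
    using pctx_extend by metis
  with 1 show ?case by (metis clean_Par herbrand_nf.par)
qed (use head_normal_process herbrand_nf.wit in fastforce)+


section \<open>Extraction of the Herbrand disjunction\<close>

lemma wf_big_disj: "\<forall>B\<in>set Bs. wf_fm L n B \<Longrightarrow> wf_fm L n (big_disj Bs)"
  by (induction Bs rule: big_disj.induct) auto

lemma big_disj_inject:
  "B \<in> set Bs \<Longrightarrow> \<forall>B\<in>set Bs. wf_fm L n B \<Longrightarrow> typing L n \<Gamma> v B \<Longrightarrow> clean v \<Longrightarrow>
     \<exists>s. typing L n \<Gamma> s (big_disj Bs) \<and> clean s"
proof (induction Bs rule: big_disj.induct)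
  case (3 B1 B2 Bs)
  show ?case
  proof (cases "B = B1")
    case True
    with 3 have "typing L n \<Gamma> (Inj0 (big_disj (B2 # Bs)) v) (big_disj (B1 # B2 # Bs))"
      using wf_big_disj[of "B2 # Bs"] by (auto intro: typing.Inj0)
    then show ?thesis using \<open>clean v\<close> by (fastforce simp: clean_def)
  next
    case False
    with 3 obtain s where s: "typing L n \<Gamma> s (big_disj (B2 # Bs))" "clean s" by auto
    with 3 have "typing L n \<Gamma> (Inj1 B1 s) (big_disj (B1 # B2 # Bs))"
      by (auto intro: typing.Inj1)
    then show ?thesis using \<open>clean s\<close> by (fastforce simp: clean_def)
  qed
qed auto

lemma herbrand_nf_procs:
  "herbrand_nf u \<Longrightarrow> typing L 0 \<Gamma> u (Exists A) \<Longrightarrow>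
     \<exists>ws. procs u = map (\<lambda>(m, v). Wit A m v) ws \<and> (\<forall>(m, v) \<in> set ws. wf_trm L 0 m)"
proof (induction arbitrary: \<Gamma> rule: herbrand_nf.induct)
  case (wit A' m u)
  then have "A' = A" "wf_trm L 0 m" by (auto elim: typing_WitE)
  then have "procs (Wit A' m u) = map (\<lambda>(m, v). Wit A m v) [(m, u)] \<and>
    (\<forall>(m, v) \<in> set [(m, u)]. wf_trm L 0 m)" by simp
  then show ?case by blast
next
  case (par u v A' B)
  from par.prems have "typing L 0 (Imp A' B # \<Gamma>) u (Exists A)"
    and "typing L 0 (Imp B A' # \<Gamma>) v (Exists A)" by (auto elim: typing_ParE)
  from par.IH(1)[OF this(1)] par.IH(2)[OF this(2)] obtain ws1 ws2
    where "procs u = map (\<lambda>(m, v). Wit A m v) ws1" "\<forall>(m, v) \<in> set ws1. wf_trm L 0 m"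
      and "procs v = map (\<lambda>(m, v). Wit A m v) ws2" "\<forall>(m, v) \<in> set ws2. wf_trm L 0 m"
    by blast
  then have "procs (Par A' B u v) = map (\<lambda>(m, v). Wit A m v) (ws1 @ ws2) \<and>
    (\<forall>(m, v) \<in> set (ws1 @ ws2). wf_trm L 0 m)" by auto
  then show ?case by blast
qed

lemma herbrand_nf_big_disj:
  "herbrand_nf u \<Longrightarrow> typing L 0 \<Gamma> u (Exists A) \<Longrightarrow> clean u \<Longrightarrow> \<forall>B\<in>set Bs. wf_fm L 0 B \<Longrightarrow>
     (\<And>m v. Wit A m v \<in> set (procs u) \<Longrightarrow> subst_fm 0 m A \<in> set Bs) \<Longrightarrow>
     \<exists>s. typing L 0 \<Gamma> s (big_disj Bs) \<and> clean s"
proof (induction arbitrary: \<Gamma> rule: herbrand_nf.induct)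
  case (wit A' m u)
  then have "typing L 0 \<Gamma> u (subst_fm 0 m A)" "A' = A" by (auto elim: typing_WitE)
  with wit show ?case by (intro big_disj_inject) (auto simp: clean_def)
next
  case (par u v A' B)
  then have wf: "wf_fm L 0 A'" "wf_fm L 0 B" and ty: "typing L 0 (Imp A' B # \<Gamma>) u (Exists A)"
    "typing L 0 (Imp B A' # \<Gamma>) v (Exists A)" by (auto elim: typing_ParE)
  obtain s1 where s1: "typing L 0 (Imp A' B # \<Gamma>) s1 (big_disj Bs)" "clean s1"
    using par.IH(1)[OF ty(1)] par.prems by auto
  obtain s2 where s2: "typing L 0 (Imp B A' # \<Gamma>) s2 (big_disj Bs)" "clean s2"
    using par.IH(2)[OF ty(2)] par.prems by auto
  show ?case using typing.Par[OF wf s1(1) s2(1)] s1 s2 by (metis clean_Par)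
qed

theorem theorem4p3:
  fixes L :: "('f, 'p) lang" and A :: "('f, 'p) fm" and t u :: "('f, 'p) pterm"
  assumes "wf_fm L 0 (Exists A)"
    and "realizes L t (Exists A)"
    and "free_pvars t = {}" and "\<not> has_abort t"
    and "(head_step L)\<^sup>*\<^sup>* t u" and "head_normal L u"
  shows "herbrand_nf u \<and>
    (\<exists>ws. procs u = map (\<lambda>(m, v). Wit A m v) ws \<and>
          LC_provable L (big_disj (map (\<lambda>(m, v). subst_fm 0 m A) ws)))"
proof -
  have "has_type L t (Exists A)" "clean t" using assms by (auto simp: clean_def)
  then have ty: "has_type L u (Exists A)" and cl: "clean u"
    using head_steps_preserve assms(5) by blast+
  have nf: "herbrand_nf u" using herbrand_nf_process[of L Hole u A] assms(6) ty cl by simp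
  obtain ws where ws: "procs u = map (\<lambda>(m, v). Wit A m v) ws" "\<forall>(m, v) \<in> set ws. wf_trm L 0 m"
    using herbrand_nf_procs[OF nf ty] by blast
  let ?Bs = "map (\<lambda>(m, v). subst_fm 0 m A) ws"
  have "\<forall>B\<in>set ?Bs. wf_fm L 0 B" using ws(2) assms(1) by (auto intro: wf_subst_fm)
  moreover have "subst_fm 0 m A \<in> set ?Bs" if "Wit A m v \<in> set (procs u)" for m v
    using that ws(1) by force
  ultimately obtain s where "has_type L s (big_disj ?Bs)" "clean s"
    using herbrand_nf_big_disj[OF nf ty cl] by blast
  then show ?thesis using nf ws(1) unfolding LC_provable_def clean_def by blast
qed

end
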